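(* Let $(\mathcal{X},d)$ be a complete metric space, let $f\colon\mathcal{X}\to\mathbb{R}\cup\{+\infty\}$ be a closed function, and let $x\in\mathcal{X}$ be a point with $f(x)$ finite. Let $f_x\colon\mathcal{X}\to\mathbb{R}\cup\{+\infty\}$ be a closed function such that $$|f_x(y)-f(y)|\leq\omega(d(x,y))\quad\text{for all } y\in\mathcal{X},$$ where $\omega$ is some growth function. Let $\epsilon\ge 0$ and let $x^+$ be a point satisfying $f_x(x^+)\leq\inf f_x+\epsilon$. Then for any constant $\rho>0$, there exist two points $z,\hat x\in\mathcal{X}$ satisfying 1. (point proximity) $d(x^+,z)\leq\frac{\epsilon}{\rho}$ and $d(z,\hat x)\leq 2\cdot\frac{\omega(d(z,x))}{\omega'(d(z,x))}$, under the convention $\frac00=0$, 2. (value proximity) $f(\hat x)\leq f(x^+)+2\omega(d(z,x))+\omega(d(x^+,x))$, 3. (near-stationarity) $|\nabla f|(\hat x)\leq\rho+\omega'(d(z,x))+\omega'(d(\hat x,x))$.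
   Context: A function on a metric space is called closed if it is lower-semicontinuous. A growth function is a differentiable function $\omega\colon[0,\infty)\to[0,\infty)$ (one-sided derivative at $0$) with $\omega(0)=\omega'(0)=0$ and $\omega'>0$ on $(0,\infty)$. The slope of $f$ at a point $\bar x$ with $f(\bar x)$ finite is $|\nabla f|(\bar x):=\limsup_{x\to\bar x,\,x\ne\bar x}\frac{(f(\bar x)-f(x))^+}{d(\bar x,x)}$, where $r^+=\max\{0,r\}$ (it is $0$ if $\bar x$ is isolated); by convention $|\nabla f|(\bar x)=+\infty$ where $f(\bar x)=+\infty$. The inequality $|f_x(y)-f(y)|\le\omega(d(x,y))$ is understood to mean that $f_x(y)$ and $f(y)$ are either both $+\infty$ or both finite and satisfying the inequality. *)

theory Defs
  imports "HOL-Analysis.Analysis"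
begin

text \<open>
  Functions with values in the reals extended by plus infinity are modelled as
  \<^typ>\<open>ereal\<close>-valued functions that never take the value minus infinity.
\<close>

definition closed_fun :: "('a::metric_space \<Rightarrow> ereal) \<Rightarrow> bool"
  where "closed_fun f \<longleftrightarrow> (\<forall>x. f x \<le> Liminf (at x) f)"

text \<open>
  A growth function lives on the half-line; its values at negative reals are never
  constrained, and all derivatives are taken within the half-line, so that the
  derivative at 0 is the one-sided one.
\<close>

definition halfline_deriv :: "(real \<Rightarrow> real) \<Rightarrow> real \<Rightarrow> real"
  where "halfline_deriv \<omega> t = vector_derivative \<omega> (at t within {0..})"

definition growth_function :: "(real \<Rightarrow> real) \<Rightarrow> bool"
  where "growth_function \<omega> \<longleftrightarrow>
    (\<forall>t\<ge>0. \<omega> t \<ge> 0) \<and>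
    \<omega> differentiable_on {0..} \<and>
    \<omega> 0 = 0 \<and> halfline_deriv \<omega> 0 = 0 \<and>
    (\<forall>t>0. halfline_deriv \<omega> t > 0)"

text \<open>
  The isolated case is separate because the \<^const>\<open>Limsup\<close> along the trivial
  filter is minus infinity.
\<close>

definition slope :: "('a::metric_space \<Rightarrow> ereal) \<Rightarrow> 'a \<Rightarrow> ereal"
  where "slope f xbar =
    (if f xbar = \<infinity> then \<infinity>
     else if \<not> xbar islimpt UNIV then 0
     else Limsup (at xbar) (\<lambda>x. max 0 (f xbar - f x) / ereal (dist xbar x)))"

text \<open>
  The reading of \<open>\<bar>a - b\<bar> \<le> r\<close> for extended values:
  both are plus infinity, or both are finite and satisfy the inequality.
\<close>

definition ext_close :: "ereal \<Rightarrow> ereal \<Rightarrow> real \<Rightarrow> bool"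
  where "ext_close a b r \<longleftrightarrow>
    (a = \<infinity> \<and> b = \<infinity>) \<or>
    (\<bar>a\<bar> \<noteq> \<infinity> \<and> \<bar>b\<bar> \<noteq> \<infinity> \<and> \<bar>a - b\<bar> \<le> ereal r)"

end

theory Submission
  imports Defs
begin

text \<open>
  Ekeland's variational principle is applied twice. The first application, to \<open>f\<^sub>x\<close>, gives a
  point \<open>z\<close> with \<open>d(xp, z) \<le> \<epsilon>/\<rho>\<close> that minimizes \<open>f\<^sub>x + \<rho> d(z, \<cdot>)\<close>. Hence \<open>z\<close> minimizes the
  majorant \<open>h = f + \<omega>(d(x, \<cdot>)) + \<rho> d(z, \<cdot>)\<close> up to an error \<open>2 \<omega>(d(z, x))\<close>. The second application,
  to \<open>h\<close> with the constant \<open>\<omega>'(d(z, x))\<close>, gives \<open>xh\<close>; if that constant vanishes then \<open>z = x\<close> is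
  already an exact minimizer of \<open>h\<close>. Since \<open>xh\<close> minimizes \<open>h + \<omega>'(d(z, x)) d(xh, \<cdot>)\<close>, the
  decrease of \<open>f\<close> near \<open>xh\<close> is controlled by the rates of the three perturbations.
\<close>

section \<open>Lower semicontinuous functions with extended values\<close>

lemma closed_fun_add_continuous:
  fixes f :: "'a::metric_space \<Rightarrow> ereal" and g :: "'a \<Rightarrow> real"
  assumes "closed_fun f" and "continuous_on UNIV g"
  shows "closed_fun (\<lambda>y. f y + ereal (g y))"
  unfolding closed_fun_def le_Liminf_iff
proof (intro allI impI)
  fix u c assume "c < f u + ereal (g u)"
  then have "c - ereal (g u) < f u"
    by (simp add: ereal_minus_less add.commute)
  \<comment> \<open>A real \<open>r\<close> strictly below \<open>f u\<close> keeps the limit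
    argument among finite values, even if \<open>f u\<close> is infinite.\<close>
  then obtain r where r: "c - ereal (g u) < ereal r" "ereal r < f u"
    using ereal_dense2 by blast
  have "isCont g u"
    using assms(2) by (simp add: continuous_on_eq_continuous_at)
  then have "((\<lambda>y. ereal (r + g y)) \<longlongrightarrow> ereal (r + g u)) (at u)"
    by (intro tendsto_intros) (simp add: isCont_def)
  moreover have "c < ereal (r + g u)"
    using r(1) by (simp add: ereal_minus_less)
  ultimately have 1: "\<forall>\<^sub>F y in at u. c < ereal (r + g y)"
    by (rule order_tendstoD)
  have 2: "\<forall>\<^sub>F y in at u. ereal r < f y"
    using assms(1) r(2) unfolding closed_fun_def le_Liminf_iff by blast
  show "\<forall>\<^sub>F y in at u. c < f y + ereal (g y)"
    using 1 2
  proof eventually_elim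
    case (elim y)
    have "ereal (r + g y) \<le> f y + ereal (g y)"
      using elim(2) by (cases "f y") auto
    with elim(1) show ?case by (rule less_le_trans)
  qed
qed

lemma closed_sublevel:
  fixes f :: "'a::metric_space \<Rightarrow> ereal"
  assumes "closed_fun f"
  shows "closed {y. f y \<le> c}"
proof -
  have "open {y. c < f y}"
  proof (subst open_subopen, rule ballI)
    fix u assume u: "u \<in> {y. c < f y}"
    then have "\<forall>\<^sub>F y in at u. c < f y"
      using assms by (simp add: closed_fun_def le_Liminf_iff)
    \<comment> \<open>The punctured filter \<open>at u\<close> ignores \<open>u\<close> itself,
      where the inequality holds by \<open>u\<close>.\<close>
    then have "\<forall>\<^sub>F y in nhds u. c < f y"
      unfolding eventually_at_filter by (rule eventually_mono) (use u in auto)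
    then show "\<exists>T. open T \<and> u \<in> T \<and> T \<subseteq> {y. c < f y}"
      by (auto simp: eventually_nhds)
  qed
  moreover have "{y. f y \<le> c} = - {y. c < f y}" by auto
  ultimately show ?thesis by (simp only: closed_Compl)
qed

section \<open>Ekeland's variational principle\<close>

text \<open>The point \<open>z\<close> is a minimal element below \<open>x0\<close> in the order in
  which \<open>S y\<close> collects the points below \<open>y\<close>. It is the common point of a
  nested sequence of closed sets \<open>S (Y n)\<close> with diameters tending to 0, which exists by
  completeness.\<close>

theorem ekeland:
  fixes f :: "'a::complete_space \<Rightarrow> ereal"
  assumes lsc: "closed_fun f" and lower: "\<And>y. ereal m \<le> f y"
    and fin: "f x0 \<noteq> \<infinity>" and c: "c > 0"
  obtains z where "f z + ereal (c * dist x0 z) \<le> f x0"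
    and "\<And>y. f z \<le> f y + ereal (c * dist z y)"
proof -
  define S where "S y = {u. f u + ereal (c * dist y u) \<le> f y}" for y
  have closed_S: "closed (S y)" for y
    unfolding S_def
    by (intro closed_sublevel closed_fun_add_continuous lsc continuous_intros)
  have refl_S: "y \<in> S y" for y
    unfolding S_def by (simp flip: zero_ereal_def)
  have trans_S: "v \<in> S y" if "v \<in> S u" "u \<in> S y" for u v y
  proof -
    have "c * dist y v \<le> c * dist u v + c * dist y u"
      using dist_triangle[of y v u] c by (simp flip: distrib_left add: add.commute)
    then have "f v + ereal (c * dist y v) \<le> f v + ereal (c * dist u v) + ereal (c * dist y u)"
      by (cases "f v") auto
    also have "\<dots> \<le> f u + ereal (c * dist y u)"
      using that(1) unfolding S_def by (simp add: add_right_mono)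
    also have "\<dots> \<le> f y"
      using that(2) unfolding S_def by simp
    finally show ?thesis unfolding S_def by simp
  qed
  have fin_S: "f u \<noteq> \<infinity>" if "u \<in> S y" "f y \<noteq> \<infinity>" for u y
    using that unfolding S_def by auto
  have step: "\<exists>u. u \<in> S y \<and> f u \<noteq> \<infinity> \<and> (\<forall>v\<in>S u. c * dist u v \<le> e)"
    if y: "f y \<noteq> \<infinity>" and e: "e > 0" for y e
  proof -
    \<comment> \<open>Let \<open>u\<close> come within \<open>e\<close> of the infimum of
      \<open>f\<close> over \<open>S y\<close>. Any \<open>v\<close> in \<open>S u\<close> is again
      in \<open>S y\<close>, so \<open>f\<close> drops by at most \<open>e\<close> from
      \<open>u\<close> to \<open>v\<close>, and that drop dominates
      \<open>c * dist u v\<close>.\<close>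
    let ?I = "INF v\<in>S y. f v"
    have "ereal m \<le> ?I" using lower by (rule INF_greatest)
    moreover have "?I \<le> f y" using refl_S by (rule INF_lower)
    ultimately have I: "\<bar>?I\<bar> \<noteq> \<infinity>" using y by auto
    then have "?I < ?I + ereal e" using e by (cases ?I) auto
    then obtain u where u: "u \<in> S y" "f u < ?I + ereal e"
      by (auto simp: INF_less_iff)
    have "c * dist u v \<le> e" if v: "v \<in> S u" for v
    proof -
      have "f v + ereal (c * dist u v) \<le> f u" using v unfolding S_def by simp
      also have "\<dots> \<le> ?I + ereal e" using u(2) by simp
      also have "\<dots> \<le> f v + ereal e"
        using trans_S[OF v u(1)] by (intro add_right_mono INF_lower)
      finally show ?thesis
        using fin_S[OF trans_S[OF v u(1)] y] lower[of v] by (cases "f v") auto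
    qed
    then show ?thesis using u(1) fin_S[OF u(1) y] by blast
  qed
  \<comment> \<open>The sequence starts at some point of \<open>S x0\<close> instead of
    \<open>x0\<close>, so that the radius bound holds from index 0 on.\<close>
  have "\<exists>Y. \<forall>n. (Y n \<in> S x0 \<and> f (Y n) \<noteq> \<infinity> \<and> (\<forall>v\<in>S (Y n). c * dist (Y n) v \<le> 1 / real (Suc n)))
      \<and> Y (Suc n) \<in> S (Y n)"
  proof (rule dependent_nat_choice)
    show "\<exists>y. y \<in> S x0 \<and> f y \<noteq> \<infinity> \<and> (\<forall>v\<in>S y. c * dist y v \<le> 1 / real (Suc 0))"
      using step[OF fin, of "1 / real (Suc 0)"] by simp
  next
    fix y n
    assume "y \<in> S x0 \<and> f y \<noteq> \<infinity> \<and> (\<forall>v\<in>S y. c * dist y v \<le> 1 / real (Suc n))"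
    then show "\<exists>u. (u \<in> S x0 \<and> f u \<noteq> \<infinity> \<and> (\<forall>v\<in>S u. c * dist u v \<le> 1 / real (Suc (Suc n))))
        \<and> u \<in> S y"
      using step[of y "1 / real (Suc (Suc n))"] trans_S[of _ y x0] by fastforce
  qed
  then obtain Y where Y: "\<And>n. Y n \<in> S x0" "\<And>n. f (Y n) \<noteq> \<infinity>"
      "\<And>n v. v \<in> S (Y n) \<Longrightarrow> c * dist (Y n) v \<le> 1 / real (Suc n)"
      "\<And>n. Y (Suc n) \<in> S (Y n)"
    by blast
  have diam: "\<exists>n. \<forall>u\<in>S (Y n). \<forall>v\<in>S (Y n). dist u v < e" if e: "e > 0" for e
  proof -
    obtain n where n: "inverse (real (Suc n)) < c * e / 2"
      using reals_Archimedean[of "c * e / 2"] c e by auto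
    have *: "dist (Y n) v < e / 2" if "v \<in> S (Y n)" for v
    proof -
      have "c * dist (Y n) v < c * (e / 2)"
        using Y(3)[OF that] n by (simp add: inverse_eq_divide)
      then show ?thesis using c by simp
    qed
    show ?thesis
      by (meson * dist_triangle_half_r)
  qed
  have decr: "S (Y n) \<subseteq> S (Y k)" if "k \<le> n" for k n
    using that
  proof (induction rule: dec_induct)
    case (step n)
    then show ?case using trans_S[OF _ Y(4)[of n]] by blast
  qed simp
  obtain z where z: "\<And>n. z \<in> S (Y n)"
    using decreasing_closed_nest[of "\<lambda>n. S (Y n)"] closed_S refl_S decr diam
    by (metis empty_iff)
  show thesis
  proof
    show "f z + ereal (c * dist x0 z) \<le> f x0"
      using trans_S[OF z[of 0] Y(1)[of 0]] unfolding S_def by simp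
    show "f z \<le> f y + ereal (c * dist z y)" for y
    \<comment> \<open>A violating \<open>y\<close> would lie in \<open>S z\<close>, hence in every
      \<open>S (Y n)\<close>, and the shrinking diameters force \<open>y = z\<close>.\<close>
    proof (rule ccontr)
      assume neg: "\<not> ?thesis"
      then have "y \<in> S z" unfolding S_def by simp
      then have "y \<in> S (Y n)" for n using trans_S z by blast
      then have "dist z y < e" if "e > 0" for e using diam[OF that] z by blast
      then have "z = y" using zero_less_dist_iff by blast
      with neg show False by (simp flip: zero_ereal_def)
    qed
  qed
qed

section \<open>Growth functions and the slope at a perturbed minimizer\<close>

lemma growth_function_deriv_nonneg:
  assumes "growth_function \<omega>" and "t \<ge> 0"
  shows "halfline_deriv \<omega> t \<ge> 0"
proof (cases "t = 0")
  case True
  with assms show ?thesis by (simp add: growth_function_def)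
next
  case False
  with assms have "halfline_deriv \<omega> t > 0" by (simp add: growth_function_def)
  then show ?thesis by simp
qed

lemma growth_function_has_derivative:
  assumes "growth_function \<omega>" and "t \<ge> 0"
  shows "(\<omega> has_derivative (\<lambda>h. h * halfline_deriv \<omega> t)) (at t within {0..})"
proof -
  have "\<omega> differentiable at t within {0..}"
    using assms unfolding growth_function_def differentiable_on_def by auto
  then show ?thesis
    unfolding vector_derivative_works has_vector_derivative_def halfline_deriv_def by simp
qed

text \<open>Minimality bounds the decrease of \<open>f\<close> from \<open>u\<close> to
  \<open>y\<close> by \<open>c * dist u y\<close> plus the increase of \<open>\<omega>\<close>.
  Since \<open>dist x\<close> is 1-Lipschitz, the latter is at most
  \<open>halfline_deriv \<omega> (dist x u) * dist u y\<close> to first order.\<close>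

lemma slope_le_if_perturbed_min:
  fixes f :: "'a::metric_space \<Rightarrow> ereal"
  assumes \<omega>: "growth_function \<omega>" and f: "\<And>y. f y \<noteq> -\<infinity>" and fin: "f u \<noteq> \<infinity>" and c: "c \<ge> 0"
    and min: "\<And>y. f u + ereal (\<omega> (dist x u)) \<le> f y + ereal (\<omega> (dist x y) + c * dist u y)"
  shows "slope f u \<le> ereal (c + halfline_deriv \<omega> (dist x u))"
proof (cases "u islimpt UNIV")
  case False
  then show ?thesis
    using fin c growth_function_deriv_nonneg[OF \<omega>, of "dist x u"]
    by (simp add: slope_def)
next
  case True
  let ?t = "dist x u" and ?D = "halfline_deriv \<omega> (dist x u)"
  have D: "?D \<ge> 0" by (rule growth_function_deriv_nonneg[OF \<omega>]) simp
  have "Limsup (at u) (\<lambda>y. max 0 (f u - f y) / ereal (dist u y)) \<le> ereal (c + ?D)"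
  proof (rule ereal_le_epsilon2)
    fix e :: real assume e: "0 < e"
    \<comment> \<open>Distances are nonnegative, so the derivative within the half-line suffices,
      also for \<open>u = x\<close>, where it is one-sided.\<close>
    obtain d where d: "d > 0"
      and ineq: "\<And>s. s \<ge> 0 \<Longrightarrow> \<bar>s - ?t\<bar> < d \<Longrightarrow> \<bar>\<omega> s - \<omega> ?t - (s - ?t) * ?D\<bar> \<le> e * \<bar>s - ?t\<bar>"
      using growth_function_has_derivative[OF \<omega>, of ?t] e
      unfolding has_derivative_within_alt by fastforce
    have "max 0 (f u - f y) / ereal (dist u y) \<le> ereal (c + ?D) + ereal e"
      if y: "y \<noteq> u" "dist y u < d" for y
    proof -
      let ?s = "dist x y"
      have st: "\<bar>?s - ?t\<bar> \<le> dist u y"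
        using dist_triangle[of x y u] dist_triangle[of x u y]
        by (simp add: dist_commute abs_le_iff)
      have "\<omega> ?s - \<omega> ?t \<le> (?s - ?t) * ?D + e * \<bar>?s - ?t\<bar>"
        using ineq[of ?s] st y(2) by (simp add: dist_commute)
      also have "\<dots> \<le> \<bar>?s - ?t\<bar> * (?D + e)"
        using mult_right_mono[OF abs_ge_self D, of "?s - ?t"] by (simp add: algebra_simps)
      also have "\<dots> \<le> dist u y * (?D + e)"
        using st D e by (intro mult_right_mono) auto
      finally have \<omega>_incr: "\<omega> ?s - \<omega> ?t \<le> dist u y * (?D + e)" .
      have pos: "0 < dist u y" using y(1) by simp
      have nonneg: "0 \<le> dist u y * (c + ?D + e)" using c D e by simp
      have "max 0 (f u - f y) \<le> ereal (dist u y * (c + ?D + e))"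
      proof (cases "f y")
        case (real r)
        moreover obtain q where "f u = ereal q" using f[of u] fin by (cases "f u") auto
        ultimately show ?thesis
          using min[of y] \<omega>_incr nonneg
          by (auto simp: max_def algebra_simps simp flip: zero_ereal_def)
      next
        case PInf
        then show ?thesis using fin nonneg by (cases "f u") (auto simp: max_def)
      qed (use f in simp)
      then show ?thesis
        using pos by (subst ereal_divide_le_pos) (auto simp: add.assoc)
    qed
    then have "\<forall>\<^sub>F y in at u. max 0 (f u - f y) / ereal (dist u y) \<le> ereal (c + ?D) + ereal e"
      unfolding eventually_at using d by blast
    then show "Limsup (at u) (\<lambda>y. max 0 (f u - f y) / ereal (dist u y)) \<le> ereal (c + ?D) + ereal e"
      by (rule Limsup_bounded)
  qed
  then show ?thesis using True fin by (simp add: slope_def)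
qed

section \<open>Near-stationarity under perturbation of the function\<close>

theorem theorem5p1:
  fixes f f\<^sub>x :: "'a::complete_space \<Rightarrow> ereal"
    and x xp :: 'a
    and \<omega> :: "real \<Rightarrow> real"
    and \<epsilon> \<rho> :: real
  assumes "\<And>y. f y \<noteq> -\<infinity>" and "closed_fun f"
    and "\<bar>f x\<bar> \<noteq> \<infinity>"
    and "\<And>y. f\<^sub>x y \<noteq> -\<infinity>" and "closed_fun f\<^sub>x"
    and "growth_function \<omega>"
    and "\<And>y. ext_close (f\<^sub>x y) (f y) (\<omega> (dist x y))"
    and "\<epsilon> \<ge> 0"
    and "f\<^sub>x xp \<le> (INF y. f\<^sub>x y) + ereal \<epsilon>"
    and "\<rho> > 0"
  shows "\<exists>z xh.
    dist xp z \<le> \<epsilon> / \<rho> \<and>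
    dist z xh \<le> 2 * (\<omega> (dist z x) / halfline_deriv \<omega> (dist z x)) \<and>
    f xh \<le> f xp + ereal (2 * \<omega> (dist z x) + \<omega> (dist xp x)) \<and>
    slope f xh \<le> ereal (\<rho> + halfline_deriv \<omega> (dist z x) + halfline_deriv \<omega> (dist xh x))"
proof -
  note f = assms(1) and f\<^sub>x = assms(4) and \<omega> = assms(6) and close = assms(7)
  let ?D = "\<lambda>t. halfline_deriv \<omega> t"
  have \<omega>_nonneg: "\<omega> t \<ge> 0" if "t \<ge> 0" for t
    using \<omega> that unfolding growth_function_def by blast
  have D_nonneg: "?D t \<ge> 0" if "t \<ge> 0" for t
    using growth_function_deriv_nonneg[OF \<omega> that] .
  have cont_\<omega>: "continuous_on {0..} \<omega>"
    using \<omega> unfolding growth_function_def by (blast intro: differentiable_imp_continuous_on)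

  have upper: "f\<^sub>x y \<le> f y + ereal (\<omega> (dist x y))" and lower: "f y \<le> f\<^sub>x y + ereal (\<omega> (dist x y))" for y
    using close[of y] unfolding ext_close_def
    by (cases "f\<^sub>x y"; cases "f y"; force)+

  \<comment> \<open>Ekeland's principle needs a real lower bound. An infimum of minus infinity would
    force that value at the near-minimizer \<open>xp\<close>.\<close>
  let ?I = "INF y. f\<^sub>x y"
  have "?I \<le> f\<^sub>x x" by (rule INF_lower) simp
  also have "f\<^sub>x x < \<infinity>" using upper[of x] assms(3) by auto
  finally have "?I \<noteq> \<infinity>" by simp
  moreover have "?I \<noteq> -\<infinity>" using assms(9) f\<^sub>x[of xp] by auto
  ultimately obtain m where m: "?I = ereal m" by (cases ?I) auto
  have m_le: "ereal m \<le> f\<^sub>x y" for y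
    unfolding m[symmetric] by (rule INF_lower) simp
  have xp_le: "f\<^sub>x xp \<le> ereal (m + \<epsilon>)" using assms(9) m by simp
  then have xp_fin: "f\<^sub>x xp \<noteq> \<infinity>" by auto

  obtain z where z: "f\<^sub>x z + ereal (\<rho> * dist xp z) \<le> f\<^sub>x xp"
    and z_min: "\<And>y. f\<^sub>x z \<le> f\<^sub>x y + ereal (\<rho> * dist z y)"
    using ekeland[OF assms(5) m_le xp_fin assms(10)] by blast
  have "\<rho> * dist xp z \<le> \<epsilon>"
  proof -
    have "ereal m + ereal (\<rho> * dist xp z) \<le> f\<^sub>x z + ereal (\<rho> * dist xp z)"
      using m_le by (rule add_right_mono)
    also have "\<dots> \<le> ereal (m + \<epsilon>)" using z xp_le by (rule order_trans)
    finally show ?thesis by simp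
  qed
  then have dist_z: "dist xp z \<le> \<epsilon> / \<rho>"
    using assms(10) by (simp add: pos_le_divide_eq mult.commute)
  have "0 \<le> \<rho> * dist xp z" using assms(10) by simp
  then have z_le_xp: "f\<^sub>x z \<le> f\<^sub>x xp" using z by (cases "f\<^sub>x z") (auto intro: order_trans[rotated])
  then have f\<^sub>xz_fin: "f\<^sub>x z \<noteq> \<infinity>" using xp_fin by auto
  then have fz_fin: "f z \<noteq> \<infinity>" using lower[of z] by auto

  define h where "h y = f y + ereal (\<omega> (dist x y) + \<rho> * dist z y)" for y
  have h_z: "h z = f z + ereal (\<omega> (dist x z))" unfolding h_def by simp
  have h_ge: "f\<^sub>x y + ereal (\<rho> * dist z y) \<le> h y" for y
    using add_right_mono[OF upper[of y], of "ereal (\<rho> * dist z y)"]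
    unfolding h_def by (simp add: add.assoc)
  have z_le_h: "f\<^sub>x z \<le> h y" for y
    using z_min h_ge order_trans by blast
  have h_fin: "h y \<noteq> -\<infinity>" for y
    using z_le_h[of y] f\<^sub>x[of z] by auto
  \<comment> \<open>One \<open>\<omega>\<close> is the perturbation inside \<open>h z\<close>, the
    other the cost of passing from \<open>f\<close> to \<open>f\<^sub>x\<close>.\<close>
  have h_z_le: "h z \<le> f\<^sub>x z + ereal (2 * \<omega> (dist z x))"
    using lower[of z] unfolding h_z
    by (cases "f z"; cases "f\<^sub>x z") (auto simp: dist_commute)
  have h_lsc: "closed_fun h"
    unfolding h_def
    by (intro closed_fun_add_continuous assms(2) continuous_intros
        continuous_on_compose2[OF cont_\<omega>]) auto

  \<comment> \<open>The clause \<open>xh_eq\<close> serves the proximity bound: for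
    \<open>z = x\<close> its quotient is \<open>0 / 0\<close>, which is 0, so only
    \<open>xh = z\<close> is admissible.\<close>
  obtain xh where xh: "h xh + ereal (?D (dist z x) * dist z xh) \<le> h z"
    and xh_min: "\<And>y. h xh \<le> h y + ereal (?D (dist z x) * dist xh y)"
    and xh_eq: "z = x \<Longrightarrow> xh = z"
  proof (cases "z = x")
    case True
    have "\<omega> 0 = 0" using \<omega> unfolding growth_function_def by blast
    then have "h z \<le> h y" for y
      using z_le_h[of y] h_z_le True by (auto intro: order_trans simp flip: zero_ereal_def)
    moreover have "?D (dist z x) = 0"
      using \<omega> True unfolding growth_function_def by simp
    ultimately show ?thesis
      using that[of z] by (simp flip: zero_ereal_def)
  next
    case False
    then have D_pos: "?D (dist z x) > 0"
      using \<omega> unfolding growth_function_def by simp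
    obtain k where "f\<^sub>x z = ereal k" using f\<^sub>x[of z] f\<^sub>xz_fin by (cases "f\<^sub>x z") auto
    then have k: "\<And>y. ereal k \<le> h y" using z_le_h by simp
    have "h z \<noteq> \<infinity>" using h_z fz_fin by simp
    from ekeland[OF h_lsc k this D_pos] False show ?thesis using that by blast
  qed

  \<comment> \<open>Both \<open>h xh\<close> and \<open>h z\<close> lie between
    \<open>f\<^sub>x z\<close> and \<open>f\<^sub>x z\<close> plus twice
    \<open>\<omega> (dist z x)\<close>, which limits the Ekeland penalty.\<close>
  have "f\<^sub>x z + ereal (?D (dist z x) * dist z xh) \<le> h xh + ereal (?D (dist z x) * dist z xh)"
    using z_le_h by (rule add_right_mono)
  also have "\<dots> \<le> f\<^sub>x z + ereal (2 * \<omega> (dist z x))"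
    using xh h_z_le by (rule order_trans)
  finally have "?D (dist z x) * dist z xh \<le> 2 * \<omega> (dist z x)"
    using f\<^sub>x[of z] f\<^sub>xz_fin by (cases "f\<^sub>x z") auto
  moreover have "?D (dist z x) > 0" if "z \<noteq> x"
    using \<omega> that unfolding growth_function_def by simp
  ultimately have dist_xh: "dist z xh \<le> 2 * (\<omega> (dist z x) / ?D (dist z x))"
    using xh_eq \<omega>_nonneg[of "dist z x"] D_nonneg[of "dist z x"]
    by (cases "z = x") (auto simp: pos_le_divide_eq mult.commute)

  have "f xh \<le> h xh"
    unfolding h_def using \<omega>_nonneg[of "dist x xh"] assms(10) by (cases "f xh") auto
  also have "\<dots> \<le> h xh + ereal (?D (dist z x) * dist z xh)"
    using D_nonneg[of "dist z x"] by (cases "h xh") auto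
  also note xh
  finally have xh_le_hz: "f xh \<le> h z" .
  also note h_z_le
  also have "f\<^sub>x z + ereal (2 * \<omega> (dist z x)) \<le> f\<^sub>x xp + ereal (2 * \<omega> (dist z x))"
    using z_le_xp by (rule add_right_mono)
  also have "\<dots> \<le> f xp + ereal (\<omega> (dist x xp)) + ereal (2 * \<omega> (dist z x))"
    using upper by (rule add_right_mono)
  also have "\<dots> = f xp + ereal (2 * \<omega> (dist z x) + \<omega> (dist xp x))"
    by (simp add: add.assoc add.commute dist_commute)
  finally have value_xh: "f xh \<le> f xp + ereal (2 * \<omega> (dist z x) + \<omega> (dist xp x))" .

  have fxh_fin: "f xh \<noteq> \<infinity>"
    using xh_le_hz fz_fin h_z by auto
  have "f xh + ereal (\<omega> (dist x xh))
      \<le> f y + ereal (\<omega> (dist x y) + (\<rho> + ?D (dist z x)) * dist xh y)" for y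
  proof -
    \<comment> \<open>This recentres the first penalty from \<open>z\<close> to \<open>xh\<close>:
      the term \<open>\<rho> * dist z xh\<close> cancels, and the two Ekeland constants add
      up.\<close>
    have "\<rho> * dist z y \<le> \<rho> * dist z xh + \<rho> * dist xh y"
      using dist_triangle[of z y xh] assms(10) by (simp flip: distrib_left)
    then show ?thesis
      using xh_min[of y] f[of xh] f[of y] fxh_fin unfolding h_def
      by (cases "f xh"; cases "f y") (auto simp: distrib_right)
  qed
  then have "slope f xh \<le> ereal ((\<rho> + ?D (dist z x)) + ?D (dist x xh))"
    using D_nonneg[of "dist z x"] assms(10)
    by (intro slope_le_if_perturbed_min \<omega> f fxh_fin) auto
  then have "slope f xh \<le> ereal (\<rho> + ?D (dist z x) + ?D (dist xh x))"
    by (simp add: dist_commute)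
  with dist_z dist_xh value_xh show ?thesis by blast
qed

end
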